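(* Let $\theta>1$ be a real quadratic unit and let $x\in\mathbb R$ have a $\theta$-expansion $x=\sum_{i=-\infty}^{m} b_i\theta^i$ (with non-negative integer digits $b_i$) in which every partial sum $\sum_{i=-n}^{m} b_i\theta^i$ ($n\ge -m$) is a greedy polynomial. Then this expansion is the greedy expansion of $x$ if and only if: 1. in the case $N(\theta)=-1$, it contains no infinite Fibonacci relation; 2. in the case $N(\theta)=1$, its digit word contains no infinite forbidden block.
   Context: For $x>0$ the greedy expansion of $x$ is defined as follows: let $k\in\mathbb Z$ with $\theta^k\le x<\theta^{k+1}$, put $b_k=[x/\theta^k]$ (integer part), $r_k=\{x/\theta^k\}$ (fractional part), and recursively for $i<k$, $b_i=[\theta r_{i+1}]$, $r_i=\{\theta r_{i+1}\}$; then $x=\sum_{i=-\infty}^k b_i\theta^i$ is the greedy expansion (it is unique). A finite sum $\sum_{i=0}^n b_i\theta^i$ (or its shift by a power of $\theta$) is a greedy polynomial if it is the greedy expansion of its value. Concretely: if $N(\theta)=-1$, then $\theta^2=a\theta+1$ with an integer $a\ge1$, and a polynomial is greedy iff all $b_i\in\{0,\dots,a\}$ and $b_i=a$ implies $b_{i-1}=0$. If $N(\theta)=1$, then $\theta^2=a\theta-1$ with an integer $a\ge3$, and a polynomial is greedy iff all $b_i\in\{0,\dots,a-1\}$ and there is no subword $b_ib_{i-1}\cdots b_{i-k}$ ($k\ge1$) of the form $(a-1)(a-2)\cdots(a-2)(a-1)$ (including $(a-1)(a-1)$). An expansion $\sum_{i\le m}b_i\theta^i$ contains an infinite Fibonacci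 relation (case $N(\theta)=-1$) if there is an index $j$ with $b_{j-2t}=a$ for all $t\ge0$ (a tail $a\theta^{j}+a\theta^{j-2}+a\theta^{j-4}+\cdots$, which sums to $\theta^{j+1}$). Its digit word contains an infinite forbidden block (case $N(\theta)=1$) if there is an index $j$ with $b_j=a-1$ and $b_{j-t}=a-2$ for all $t\ge1$. *)

theory Defs
  imports Complex_Main
begin

definition quadratic_integer :: "real \<Rightarrow> bool" where
  "quadratic_integer x \<longleftrightarrow>
     x \<notin> \<rat> \<and> (\<exists>p q :: int. x ^ 2 + of_int p * x + of_int q = 0)"

(* A unit of the ring of integers of the field generated by x; as x is irrational, its
   inverse is an algebraic integer of that field iff it is a quadratic integer. *)
definition real_quadratic_unit :: "real \<Rightarrow> bool" where
  "real_quadratic_unit x \<longleftrightarrow> quadratic_integer x \<and> quadratic_integer (inverse x)"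

(* The other root of the minimal polynomial over the rationals (unique for quadratic x). *)
definition quad_conj :: "real \<Rightarrow> real" where
  "quad_conj x =
     (THE y. \<exists>p q :: rat. \<forall>t. t ^ 2 + of_rat p * t + of_rat q = (t - x) * (t - y))"

definition quad_norm :: "real \<Rightarrow> real" where
  "quad_norm x = x * quad_conj x"

definition greedy_top :: "real \<Rightarrow> real \<Rightarrow> int" where
  "greedy_top \<theta> x = (THE k. \<theta> powi k \<le> x \<and> x < \<theta> powi (k + 1))"

(* With k = greedy_top \<theta> x, the value at j is the remainder of index k - j. *)
primrec greedy_rem :: "real \<Rightarrow> real \<Rightarrow> nat \<Rightarrow> real" where
  "greedy_rem \<theta> x 0 = frac (x / \<theta> powi greedy_top \<theta> x)"
| "greedy_rem \<theta> x (Suc j) = frac (\<theta> * greedy_rem \<theta> x j)"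

(* Only meaningful for x > 0. *)
definition greedy_digit :: "real \<Rightarrow> real \<Rightarrow> int \<Rightarrow> int" where
  "greedy_digit \<theta> x i =
     (let k = greedy_top \<theta> x in
      if i > k then 0
      else if i = k then \<lfloor>x / \<theta> powi k\<rfloor>
      else \<lfloor>\<theta> * greedy_rem \<theta> x (nat (k - (i + 1)))\<rfloor>)"

(* Digits are indexed by all integers, so leading zeros are immaterial. The greedy
   expansion of 0 is the one with all digits 0, in accordance with the zero polynomial
   being greedy. *)
definition is_greedy_expansion :: "real \<Rightarrow> real \<Rightarrow> (int \<Rightarrow> nat) \<Rightarrow> bool" where
  "is_greedy_expansion \<theta> x b \<longleftrightarrow>
     (if x = 0 then \<forall>i. b i = 0
      else x > 0 \<and> (\<forall>i. int (b i) = greedy_digit \<theta> x i))"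

definition greedy_polynomial :: "real \<Rightarrow> (int \<Rightarrow> nat) \<Rightarrow> bool" where
  "greedy_polynomial \<theta> c \<longleftrightarrow>
     finite {i. c i \<noteq> 0} \<and>
     is_greedy_expansion \<theta> (\<Sum>i | c i \<noteq> 0. real (c i) * \<theta> powi i) c"

definition theta_expansion :: "real \<Rightarrow> real \<Rightarrow> int \<Rightarrow> (int \<Rightarrow> nat) \<Rightarrow> bool" where
  "theta_expansion \<theta> x m b \<longleftrightarrow>
     (\<forall>i>m. b i = 0) \<and>
     (\<lambda>t. real (b (m - int t)) * \<theta> powi (m - int t)) sums x"

definition partial_digits :: "(int \<Rightarrow> nat) \<Rightarrow> int \<Rightarrow> int \<Rightarrow> int \<Rightarrow> nat" where
  "partial_digits b m n i = (if - n \<le> i \<and> i \<le> m then b i else 0)"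

(* For irrational \<theta> there is at most one such integer a, in either definition. *)
definition has_infinite_fibonacci_relation :: "real \<Rightarrow> (int \<Rightarrow> nat) \<Rightarrow> bool" where
  "has_infinite_fibonacci_relation \<theta> b \<longleftrightarrow>
     (\<exists>a :: int. \<theta> ^ 2 = of_int a * \<theta> + 1 \<and>
        (\<exists>j. \<forall>t :: nat. int (b (j - 2 * int t)) = a))"

definition has_infinite_forbidden_block :: "real \<Rightarrow> (int \<Rightarrow> nat) \<Rightarrow> bool" where
  "has_infinite_forbidden_block \<theta> b \<longleftrightarrow>
     (\<exists>a :: int. \<theta> ^ 2 = of_int a * \<theta> - 1 \<and>
        (\<exists>j. int (b j) = a - 1 \<and> (\<forall>t :: nat. t \<ge> 1 \<longrightarrow> int (b (j - int t)) = a - 2)))"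

end

(* Let T j be the sum of the terms b i * \<theta>^i over i < j, and Y j = T j / \<theta>^j the
   normalised tail, so that \<theta> * Y (j + 1) = b j + Y j. An expansion is greedy iff Y j < 1 for
   all j. If all partial sums are greedy, then every finite truncation of Y j is below 1, hence
   Y j \<le> 1, and greediness can fail only through Y j = 1 for some j with infinitely many nonzero
   digits below j. The recurrence together with 0 \<le> Y \<le> 1 then determines all
   digits below j. If \<theta>^2 = a * \<theta> + 1, the tails run through 1, 1/\<theta>, 1, 1/\<theta>, ... and the digits
   are a, 0, a, 0, ... (the alternative digit 1 after a would terminate the expansion). If
   \<theta>^2 = a * \<theta> - 1, the tails run through 1, 1 - 1/\<theta>, 1 - 1/\<theta>, ... and the digits are
   a - 1, a - 2, a - 2, .... *)
theory Submission
  imports Defs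
begin

section \<open>Geometric growth and the leading exponent\<close>

text \<open>Drives both "greedy implies no forbidden pattern" proofs: a positive gap between a tail
  and its critical value would grow geometrically, while nonnegative tails keep it at most
  1.\<close>

lemma unbounded_if_geometric:
  fixes D :: "nat \<Rightarrow> real"
  assumes "c > 1" "D 0 > 0" and step: "\<And>t. D (Suc t) \<ge> c * D t"
  shows "\<exists>t. D t > B"
proof -
  have ge: "D t \<ge> c ^ t * D 0" for t
  proof (induction t)
    case (Suc t)
    have "c ^ Suc t * D 0 = c * (c ^ t * D 0)"
      by simp
    also have "\<dots> \<le> c * D t"
      using Suc \<open>c > 1\<close> by (intro mult_left_mono) auto
    finally show ?case
      using step[of t] by linarith
  qed simp
  obtain t where "B / D 0 < c ^ t"
    using real_arch_pow[OF \<open>c > 1\<close>] by blast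
  then have "B < c ^ t * D 0"
    using \<open>D 0 > 0\<close> by (simp add: field_simps)
  with ge[of t] show ?thesis
    by (intro exI[of _ t]) linarith
qed

lemma greedy_top_eqI:
  assumes "\<theta> > 1" "\<theta> powi k \<le> x" "x < \<theta> powi (k + 1)"
  shows "greedy_top \<theta> x = k"
  unfolding greedy_top_def
proof (rule the_equality)
  fix l assume l: "\<theta> powi l \<le> x \<and> x < \<theta> powi (l + 1)"
  have "\<theta> powi l < \<theta> powi (k + 1)" "\<theta> powi k < \<theta> powi (l + 1)"
    using l assms by linarith+
  then have "l < k + 1" "k < l + 1"
    using power_int_increasing[of _ _ \<theta>] \<open>\<theta> > 1\<close> by (meson leI less_imp_le not_le)+
  then show "l = k"
    by simp
qed (use assms in auto)

text \<open>Existence of the leading exponent, as the floor of the logarithm; it gives the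
  \<open>THE\<close> in \<open>greedy_top\<close> its intended value for
  \<open>x > 0\<close>.\<close>

lemma greedy_top_bounds:
  assumes "\<theta> > 1" "x > 0"
  shows "\<theta> powi greedy_top \<theta> x \<le> x" "x < \<theta> powi (greedy_top \<theta> x + 1)"
proof -
  define k where "k = \<lfloor>log \<theta> x\<rfloor>"
  have "of_int k \<le> log \<theta> x" "log \<theta> x < of_int (k + 1)"
    unfolding k_def by linarith+
  then have "\<theta> powr of_int k \<le> x" "x < \<theta> powr of_int (k + 1)"
    using assms by (simp_all only: le_log_iff log_less_iff)
  then have k: "\<theta> powi k \<le> x" "x < \<theta> powi (k + 1)"
    using assms powr_real_of_int'[of \<theta>] by (auto simp del: of_int_add)
  with greedy_top_eqI[OF \<open>\<theta> > 1\<close> k]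
  show "\<theta> powi greedy_top \<theta> x \<le> x" "x < \<theta> powi (greedy_top \<theta> x + 1)"
    by simp_all
qed

section \<open>Normalised tails of a convergent expansion\<close>

definition normalised_tail :: "real \<Rightarrow> (int \<Rightarrow> nat) \<Rightarrow> int \<Rightarrow> real" where
  "normalised_tail \<theta> b j = (\<Sum>t. real (b (j - 1 - int t)) / \<theta> ^ Suc t)"

locale digit_expansion =
  fixes \<theta> x :: real and m :: int and b :: "int \<Rightarrow> nat"
  assumes theta_gt_1: "\<theta> > 1" and expansion: "theta_expansion \<theta> x m b"
begin

abbreviation Y :: "int \<Rightarrow> real" where
  "Y \<equiv> normalised_tail \<theta> b"

lemma zero_above: "i > m \<Longrightarrow> b i = 0"
  using expansion by (simp add: theta_expansion_def)

lemma tail_top: "(\<lambda>t. real (b (m - int t)) / \<theta> ^ Suc t) sums (x / \<theta> powi (m + 1))"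
proof -
  have "(\<lambda>t. real (b (m - int t)) * \<theta> powi (m - int t) / \<theta> powi (m + 1)) sums (x / \<theta> powi (m + 1))"
    using expansion by (intro sums_divide) (simp add: theta_expansion_def)
  moreover have "\<theta> powi (m - int t) / \<theta> powi (m + 1) = 1 / \<theta> ^ Suc t" for t
  proof -
    have "\<theta> powi (m - int t) / \<theta> powi (m + 1) = \<theta> powi ((m - int t) - (m + 1))"
      using theta_gt_1 by (subst power_int_diff) auto
    also have "(m - int t) - (m + 1) = - int (Suc t)"
      by simp
    finally show ?thesis
      by (simp only: power_int_minus power_int_of_nat divide_inverse mult_1)
  qed
  ultimately show ?thesis
    by (simp only: times_divide_eq_right[symmetric]) simp
qed

text \<open>The two series differ by the leading term and the factor \<theta>, neither of which
  affects convergence.\<close>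

lemma summable_step:
  "summable (\<lambda>t. real (b (j - int t)) / \<theta> ^ Suc t) \<longleftrightarrow>
   summable (\<lambda>t. real (b (j - 1 - int t)) / \<theta> ^ Suc t)" (is "summable ?f \<longleftrightarrow> summable ?g")
proof -
  have "(\<lambda>t. \<theta> * ?f (Suc t)) = ?g"
    using theta_gt_1 by (auto simp: field_simps intro!: ext)
  moreover have "summable (\<lambda>t. \<theta> * ?f (Suc t)) \<longleftrightarrow> summable ?f"
    using theta_gt_1 summable_Suc_iff[of ?f] by (subst summable_cmult_iff) auto
  ultimately show ?thesis
    by simp
qed

text \<open>Convergence is given at \<open>m + 1\<close>, where the tail is the whole expansion, and
  spreads to all \<open>j\<close> in both directions.\<close>

lemma summable_tail: "summable (\<lambda>t. real (b (j - 1 - int t)) / \<theta> ^ Suc t)"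
proof (induction j rule: int_induct[where k = "m + 1"])
  case base
  show ?case
    using tail_top by (simp add: sums_iff)
next
  case (step1 i)
  then show ?case
    using summable_step[of i] by (simp add: algebra_simps)
next
  case (step2 i)
  then show ?case
    using summable_step[of "i - 1"] by simp
qed

lemma tail_nonneg: "0 \<le> Y j"
  unfolding normalised_tail_def using theta_gt_1 by (intro suminf_nonneg summable_tail) auto

lemma tail_step: "\<theta> * Y j = real (b (j - 1)) + Y (j - 1)"
proof -
  let ?f = "\<lambda>t. real (b (j - 1 - int t)) / \<theta> ^ Suc t"
  have "Y j = ?f 0 + (\<Sum>t. ?f (Suc t))"
    unfolding normalised_tail_def by (subst suminf_split_head[OF summable_tail]) auto
  then have "\<theta> * Y j = \<theta> * ?f 0 + (\<Sum>t. \<theta> * ?f (Suc t))"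
    using summable_Suc_iff[of ?f] summable_tail[of j]
    by (subst suminf_mult) (auto simp only: distrib_left)
  also have "(\<lambda>t. \<theta> * ?f (Suc t)) = (\<lambda>t. real (b (j - 1 - 1 - int t)) / \<theta> ^ Suc t)"
    using theta_gt_1 by (auto simp: field_simps intro!: ext)
  finally show ?thesis
    using theta_gt_1 by (simp add: normalised_tail_def)
qed

lemma tail_step': "\<theta> * Y (j + 1) = real (b j) + Y j"
  using tail_step[of "j + 1"] by simp

lemma partial_tail_le: "(\<Sum>t<N. real (b (j - 1 - int t)) / \<theta> ^ Suc t) \<le> Y j"
  unfolding normalised_tail_def using theta_gt_1
  by (intro sum_le_suminf summable_tail) auto

lemma digit_zero_if_tail_zero:
  assumes "Y j = 0" "i < j"
  shows "b i = 0"
proof -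
  have "real (b (j - 1 - int t)) / \<theta> ^ Suc t = 0" for t
    using assms theta_gt_1 suminf_eq_zero_iff[OF summable_tail[of j]]
    by (simp add: normalised_tail_def)
  from this[of "nat (j - 1 - i)"] show ?thesis
    using assms theta_gt_1 by auto
qed

lemma value_eq_tail_step: "\<theta> powi (j + 1) * Y (j + 1) = real (b j) * \<theta> powi j + \<theta> powi j * Y j"
proof -
  have "\<theta> powi (j + 1) * Y (j + 1) = \<theta> powi j * (\<theta> * Y (j + 1))"
    using theta_gt_1 by (simp add: power_int_add)
  then show ?thesis
    unfolding tail_step' by (simp add: algebra_simps)
qed

lemma value_eq_tail_top: "\<theta> powi (m + 1) * Y (m + 1) = x"
  using tail_top theta_gt_1 by (simp add: normalised_tail_def sums_iff)

lemma value_eq_tail: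
  assumes zero: "\<forall>i>k. b i = 0" and "j > k"
  shows "\<theta> powi j * Y j = x"
proof -
  \<comment> \<open>The premise is weakened so that the induction can start at \<open>m + 1\<close>,
    whether or not \<open>m + 1 > k\<close>. Going up uses that digits vanish above
    \<open>m\<close>, going down that they vanish above \<open>k\<close>.\<close>
  have "j > k \<or> j > m \<Longrightarrow> \<theta> powi j * Y j = x"
  proof (induction j rule: int_induct[where k = "m + 1"])
    case base
    show ?case
      by (rule value_eq_tail_top)
  next
    case (step1 i)
    then show ?case
      using value_eq_tail_step[of i] zero_above[of i] by simp
  next
    case (step2 i)
    then show ?case
      using value_eq_tail_step[of "i - 1"] zero by auto
  qed
  with \<open>j > k\<close> show ?thesis
    by simp
qed

lemma leading_quotient:
  assumes "\<forall>i>k. b i = 0"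
  shows "x / \<theta> powi k = real (b k) + Y k"
proof -
  have "x = (real (b k) + Y k) * \<theta> powi k"
    using value_eq_tail_step[of k] value_eq_tail[OF assms, of "k + 1"] by (simp add: algebra_simps)
  then show ?thesis
    using theta_gt_1 by simp
qed

lemma value_nonneg: "0 \<le> x"
  using value_eq_tail_top tail_nonneg[of "m + 1"] theta_gt_1
  by (auto simp: zero_le_mult_iff)

lemma digit_zero_if_value_zero:
  assumes "x = 0"
  shows "b i = 0"
proof (cases "i > m")
  case False
  have "Y (m + 1) = 0"
    using value_eq_tail_top theta_gt_1 assms by simp
  then show ?thesis
    using digit_zero_if_tail_zero False by simp
qed (rule zero_above)

lemma ex_leading_digit:
  assumes "x \<noteq> 0"
  obtains k where "b k \<noteq> 0" "\<forall>i>k. b i = 0"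
proof -
  obtain l where l: "b l \<noteq> 0"
  proof (rule ccontr)
    assume "\<not> thesis"
    with that have "b i = 0" for i
      by blast
    then have "Y (m + 1) = 0"
      by (simp add: normalised_tail_def)
    with value_eq_tail_top assms show False
      by simp
  qed
  \<comment> \<open>Cutting off below at the nonzero digit \<open>l\<close> makes the set finite, so
    that a maximum exists.\<close>
  define S where "S = {i. l \<le> i \<and> b i \<noteq> 0}"
  have "S \<subseteq> {l..m}"
    using zero_above unfolding S_def by (metis (mono_tags, lifting) atLeastAtMost_iff leI mem_Collect_eq subsetI)
  then have "finite S"
    by (rule finite_subset) simp
  moreover have "l \<in> S"
    using l by (simp add: S_def)
  ultimately have M: "Max S \<in> S" "i \<in> S \<Longrightarrow> i \<le> Max S" "l \<le> Max S" for i
    using Max_in[of S] Max_ge[of S] by (metis empty_iff)+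
  show thesis
  proof (rule that)
    show "b (Max S) \<noteq> 0"
      using M(1) by (simp add: S_def)
    show "\<forall>i>Max S. b i = 0"
    proof (intro allI impI)
      fix i assume "i > Max S"
      with M(2)[of i] M(3) have "i \<notin> S" "i \<ge> l"
        by auto
      then show "b i = 0"
        by (simp add: S_def)
    qed
  qed
qed

section \<open>Greediness as a bound on the tails\<close>

text \<open>When all tails lie in [0, 1), \<open>b j\<close> and \<open>Y j\<close> are the integer
  and fractional parts of their sum, so the recurrence for \<open>Y\<close> is the greedy algorithm
  itself, with remainders \<open>Y (k - n)\<close>.\<close>

lemma greedy_if_tails_less_1:
  assumes less_1: "\<And>j. Y j < 1"
  shows "is_greedy_expansion \<theta> x b"
proof (cases "x = 0")
  case True
  then show ?thesis
    using digit_zero_if_value_zero by (simp add: is_greedy_expansion_def)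
next
  case False
  then have "x > 0"
    using value_nonneg by simp
  obtain k where k: "b k \<noteq> 0" "\<forall>i>k. b i = 0"
    using ex_leading_digit[OF False] by blast
  have x: "\<theta> powi (k + 1) * Y (k + 1) = x"
    using value_eq_tail[OF k(2)] by simp
  have pos: "\<theta> powi i > 0" for i
    using theta_gt_1 by simp
  have "x < \<theta> powi (k + 1)"
    using x less_1[of "k + 1"] pos[of "k + 1"] by (metis mult.right_neutral mult_less_cancel_left_pos)
  moreover have "\<theta> powi k \<le> x"
  proof -
    have "1 * \<theta> powi k \<le> real (b k) * \<theta> powi k"
      using k(1) pos[of k] by (intro mult_right_mono) auto
    then show ?thesis
      using value_eq_tail_step[of k] x mult_nonneg_nonneg[OF less_imp_le[OF pos[of k]] tail_nonneg[of k]]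
      by linarith
  qed
  ultimately have top: "greedy_top \<theta> x = k"
    using greedy_top_eqI theta_gt_1 by blast
  note lead = leading_quotient[OF k(2)]
  have split: "\<lfloor>real (b j) + Y j\<rfloor> = int (b j)" "frac (real (b j) + Y j) = Y j" for j
    using tail_nonneg[of j] less_1[of j] by (auto simp: floor_eq_iff frac_unique_iff)
  have rem: "greedy_rem \<theta> x n = Y (k - int n)" for n
  proof (induction n)
    case 0
    show ?case
      by (simp add: top lead split)
  next
    case (Suc n)
    have "k - int n - 1 = k - int (Suc n)"
      by simp
    with Suc tail_step[of "k - int n"] split(2)[of "k - int (Suc n)"] show ?case
      by (simp del: of_nat_Suc)
  qed
  have "int (b i) = greedy_digit \<theta> x i" for i
  proof (cases i k rule: linorder_cases)
    case less
    then have "greedy_rem \<theta> x (nat (k - (i + 1))) = Y (i + 1)"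
      by (subst rem) simp
    with less show ?thesis
      by (simp add: greedy_digit_def top tail_step' split)
  next
    case equal
    then show ?thesis
      by (simp add: greedy_digit_def top lead split)
  next
    case greater
    then show ?thesis
      using k(2) by (simp add: greedy_digit_def top)
  qed
  with \<open>x > 0\<close> show ?thesis
    by (simp add: is_greedy_expansion_def)
qed

text \<open>Up to the leading index the tails are greedy remainders, hence fractional parts; above
  it \<open>Y j\<close> is \<open>x\<close> divided by a power of \<theta> that exceeds
  \<open>x\<close>.\<close>

lemma tails_less_1_if_greedy:
  assumes "is_greedy_expansion \<theta> x b"
  shows "Y j < 1"
proof (cases "x = 0")
  case True
  then have "Y j = 0"
    using digit_zero_if_value_zero by (simp add: normalised_tail_def)
  then show ?thesis
    by simp
next
  case False
  then have "x > 0" and digits: "int (b i) = greedy_digit \<theta> x i" for i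
    using assms by (auto simp: is_greedy_expansion_def)
  define k where "k = greedy_top \<theta> x"
  have k: "\<theta> powi k \<le> x" "x < \<theta> powi (k + 1)"
    using greedy_top_bounds[OF theta_gt_1 \<open>x > 0\<close>] by (simp_all add: k_def)
  have zero: "\<forall>i>k. b i = 0"
  proof (intro allI impI)
    fix i assume "i > k"
    then show "b i = 0"
      using digits[of i] by (simp add: greedy_digit_def k_def)
  qed
  have pos: "\<theta> powi i > 0" for i
    using theta_gt_1 by simp
  have rem: "Y (k - int n) = greedy_rem \<theta> x n" for n
  proof (induction n)
    case 0
    have "x / \<theta> powi k = real (b k) + Y k"
      by (rule leading_quotient[OF zero])
    moreover have "int (b k) = \<lfloor>x / \<theta> powi k\<rfloor>"
      using digits[of k] by (simp add: greedy_digit_def k_def)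
    then have "real (b k) = of_int \<lfloor>x / \<theta> powi k\<rfloor>"
      by (metis of_int_of_nat_eq)
    ultimately have "Y k = frac (x / \<theta> powi k)"
      by (simp add: frac_def)
    then show ?case
      by (simp add: k_def)
  next
    case (Suc n)
    define i where "i = k - int (Suc n)"
    have i: "i < k" "nat (k - (i + 1)) = n" "k - int n = i + 1"
      by (auto simp: i_def)
    have "int (b i) = \<lfloor>\<theta> * greedy_rem \<theta> x n\<rfloor>"
      using digits[of i] i by (simp add: greedy_digit_def k_def[symmetric])
    then have "real (b i) = of_int \<lfloor>\<theta> * greedy_rem \<theta> x n\<rfloor>"
      by (metis of_int_of_nat_eq)
    moreover have "\<theta> * greedy_rem \<theta> x n = real (b i) + Y i"
      using tail_step'[of i] Suc i(3) by simp
    ultimately have "Y i = greedy_rem \<theta> x (Suc n)"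
      by (simp add: frac_def)
    then show ?case
      by (simp add: i_def)
  qed
  show ?thesis
  proof (cases "j \<le> k")
    case True
    have "greedy_rem \<theta> x n < 1" for n
      by (cases n) (simp_all add: frac_lt_1)
    with rem[of "nat (k - j)"] True show ?thesis
      by simp
  next
    case False
    then have "\<theta> powi (k + 1) \<le> \<theta> powi j"
      using theta_gt_1 by (intro power_int_increasing) auto
    with k(2) value_eq_tail[OF zero, of j] False have "\<theta> powi j * Y j < \<theta> powi j * 1"
      by simp
    then show ?thesis
      using pos[of j] by (simp only: mult_less_cancel_left_pos)
  qed
qed

lemma greedy_iff_tails_less_1: "is_greedy_expansion \<theta> x b \<longleftrightarrow> (\<forall>j. Y j < 1)"
  using greedy_if_tails_less_1 tails_less_1_if_greedy by blast

section \<open>Greedy expansions avoid the infinite patterns\<close>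

text \<open>Over two places starting with digit \<open>a\<close>, the gap 1 - Y is multiplied by
  \<theta>^2 and then increased by the second digit, which is nonnegative. A positive gap would thus
  grow without bound.\<close>

lemma no_infinite_fibonacci_relation_if_greedy:
  assumes "is_greedy_expansion \<theta> x b"
  shows "\<not> has_infinite_fibonacci_relation \<theta> b"
proof
  assume "has_infinite_fibonacci_relation \<theta> b"
  then obtain a :: int and j where a: "\<theta> ^ 2 = of_int a * \<theta> + 1"
    and j: "\<And>t. int (b (j - 2 * int t)) = a"
    unfolding has_infinite_fibonacci_relation_def by blast
  define D where "D t = 1 - Y (j + 1 - 2 * int t)" for t
  have "D (Suc t) \<ge> \<theta> ^ 2 * D t" for t
  proof -
    define i where "i = j - 2 * int t"
    have "real (b i) = of_int a"
      using j[of t] unfolding i_def by (metis of_int_of_nat_eq)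
    then have "\<theta> * Y (i + 1) = of_int a + Y i"
      using tail_step' by simp
    then have "\<theta> ^ 2 * Y (i + 1) = of_int a * \<theta> + \<theta> * Y i"
      by (simp add: power2_eq_square algebra_simps)
    then have "\<theta> ^ 2 * (1 - Y (i + 1)) \<le> 1 - Y (i - 1)"
      using tail_step[of i] a by (simp add: algebra_simps)
    moreover have "j + 1 - 2 * int t = i + 1" "j + 1 - 2 * int (Suc t) = i - 1"
      by (simp_all add: i_def)
    ultimately show ?thesis
      unfolding D_def by (simp only:)
  qed
  moreover have "D 0 > 0"
    using tails_less_1_if_greedy[OF assms, of "j + 1"] by (simp add: D_def)
  moreover have "\<theta> ^ 2 > 1"
    using theta_gt_1 by simp
  ultimately obtain t where "D t > 1"
    using unbounded_if_geometric by blast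
  then show False
    using tail_nonneg[of "j + 1 - 2 * int t"] by (simp add: D_def)
qed

lemma no_infinite_forbidden_block_if_greedy:
  assumes "is_greedy_expansion \<theta> x b"
  shows "\<not> has_infinite_forbidden_block \<theta> b"
proof
  assume "has_infinite_forbidden_block \<theta> b"
  then obtain a :: int and j where a: "\<theta> ^ 2 = of_int a * \<theta> - 1"
    and j: "int (b j) = a - 1" "\<And>t. t \<ge> 1 \<Longrightarrow> int (b (j - int t)) = a - 2"
    unfolding has_infinite_forbidden_block_def by blast
  have a': "\<theta> = of_int a - 1 / \<theta>"
    using a theta_gt_1 by (simp add: field_simps power2_eq_square)
  \<comment> \<open>1 - 1/\<theta> is the fixed point of y -> \<theta> y - (a - 2), the map between
    successive tails in the block; each step multiplies the distance to it by \<theta>.\<close>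
  define D where "D t = 1 - 1 / \<theta> - Y (j - int t)" for t
  have "D (Suc t) \<ge> \<theta> * D t" for t
  proof -
    have "real (b (j - int t - 1)) = of_int (a - 2)"
      using j(2)[of "Suc t"] by (metis of_int_of_nat_eq diff_diff_eq of_nat_Suc add.commute le_add1 plus_1_eq_Suc)
    with tail_step[of "j - int t"]
    have "\<theta> * Y (j - int t) = of_int a - 2 + Y (j - int t - 1)"
      by simp
    moreover have "j - int t - 1 = j - int (Suc t)" "\<theta> * (1 / \<theta>) = 1"
      using theta_gt_1 by simp_all
    ultimately show ?thesis
      using a' unfolding D_def right_diff_distrib by simp
  qed
  \<comment> \<open>The digit \<open>a - 1\<close> turns Y (j + 1) < 1 into Y j < \<theta> - (a - 1)
    = 1 - 1/\<theta>.\<close>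
  moreover have "D 0 > 0"
  proof -
    have "real (b j) = of_int (a - 1)"
      using j(1) by (metis of_int_of_nat_eq)
    moreover have "\<theta> * Y (j + 1) < \<theta> * 1"
      using tails_less_1_if_greedy[OF assms] theta_gt_1 by (intro mult_strict_left_mono) auto
    ultimately show ?thesis
      using tail_step'[of j] a' by (simp add: D_def)
  qed
  ultimately obtain t where "D t > 1"
    using unbounded_if_geometric theta_gt_1 by blast
  moreover have "1 / \<theta> > 0"
    using theta_gt_1 by simp
  ultimately show False
    using tail_nonneg[of "j - int t"] by (simp add: D_def)
qed

end

section \<open>Expansions all of whose partial sums are greedy\<close>

locale greedy_partial_sums = digit_expansion +
  assumes greedy_partial: "\<And>n. n \<ge> - m \<Longrightarrow> greedy_polynomial \<theta> (partial_digits b m n)"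
begin

text \<open>Makes every truncation an instance of \<open>digit_expansion\<close>, with its value in
  the form used by \<open>greedy_polynomial\<close>, so that the results on tails apply to
  it.\<close>

lemma theta_expansion_partial_digits:
  fixes n
  defines "c \<equiv> partial_digits b m n"
  shows "theta_expansion \<theta> (\<Sum>i | c i \<noteq> 0. real (c i) * \<theta> powi i) m c"
  unfolding theta_expansion_def
proof
  show "\<forall>i>m. c i = 0"
    by (simp add: c_def partial_digits_def)
  define h where "h t = m - int t" for t
  \<comment> \<open>If \<open>n < - m\<close>, this is {0} and the only term is zero; otherwise
    \<open>h\<close> maps it onto the positions from \<open>- n\<close> to \<open>m\<close>.\<close>
  define S where "S = {..nat (m + n)}"
  have "(\<lambda>t. real (c (h t)) * \<theta> powi h t) sums (\<Sum>t\<in>S. real (c (h t)) * \<theta> powi h t)"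
    by (rule sums_finite) (auto simp: S_def h_def c_def partial_digits_def)
  also have "(\<Sum>t\<in>S. real (c (h t)) * \<theta> powi h t) = (\<Sum>i\<in>h ` S. real (c i) * \<theta> powi i)"
    by (subst sum.reindex) (auto simp: inj_on_def h_def)
  also have "\<dots> = (\<Sum>i | c i \<noteq> 0. real (c i) * \<theta> powi i)"
  proof (rule sum.mono_neutral_right)
    show "{i. c i \<noteq> 0} \<subseteq> h ` S"
    proof
      fix i assume "i \<in> {i. c i \<noteq> 0}"
      then have "- n \<le> i" "i \<le> m"
        by (auto simp: c_def partial_digits_def split: if_splits)
      then have "i = h (nat (m - i))" "nat (m - i) \<in> S"
        by (auto simp: h_def S_def)
      then show "i \<in> h ` S"
        by blast
    qed
  qed (auto simp: S_def)
  finally show "(\<lambda>t. real (c (m - int t)) * \<theta> powi (m - int t)) sums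
      (\<Sum>i | c i \<noteq> 0. real (c i) * \<theta> powi i)"
    by (simp add: h_def)
qed

lemma partial_tail_less_1: "(\<Sum>t<N. real (b (j - 1 - int t)) / \<theta> ^ Suc t) < 1"
proof -
  \<comment> \<open>The sum reaches down to position \<open>j - N\<close>, so the truncation must
    keep that position; the bound \<open>- m\<close> makes \<open>greedy_partial\<close>
    applicable.\<close>
  define n where "n = max (- m) (int N - j)"
  define c where "c = partial_digits b m n"
  interpret c: digit_expansion \<theta> "\<Sum>i | c i \<noteq> 0. real (c i) * \<theta> powi i" m c
    by unfold_locales (use theta_gt_1 theta_expansion_partial_digits in \<open>auto simp: c_def\<close>)
  have "b (j - 1 - int t) = c (j - 1 - int t)" if "t < N" for t
    using that zero_above by (auto simp: c_def partial_digits_def n_def)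
  then have "(\<Sum>t<N. real (b (j - 1 - int t)) / \<theta> ^ Suc t)
      = (\<Sum>t<N. real (c (j - 1 - int t)) / \<theta> ^ Suc t)"
    by (intro sum.cong) auto
  also have "\<dots> \<le> c.Y j"
    by (rule c.partial_tail_le)
  also have "\<dots> < 1"
    using greedy_partial[of n]
    by (intro c.tails_less_1_if_greedy) (simp add: greedy_polynomial_def c_def n_def)
  finally show ?thesis .
qed

lemma tail_le_1: "Y j \<le> 1"
  unfolding normalised_tail_def
  by (rule suminf_le_const[OF summable_tail]) (rule less_imp_le[OF partial_tail_less_1])

text \<open>If the digits ended, \<open>Y j\<close> would equal one of its partial sums, and these
  are strictly below 1.\<close>

lemma nonzero_tail_below_tail_1:
  assumes "Y j = 1"
  shows "Y (j - int N) \<noteq> 0"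
proof
  assume "Y (j - int N) = 0"
  then have "b (j - 1 - int t) = 0" if "t \<ge> N" for t
    using digit_zero_if_tail_zero that by simp
  then have "Y j = (\<Sum>t<N. real (b (j - 1 - int t)) / \<theta> ^ Suc t)"
    unfolding normalised_tail_def by (intro suminf_finite) auto
  with partial_tail_less_1 assms show False
    by (metis less_irrefl)
qed

text \<open>With tails only known to lie in the closed interval [0, 1], splitting a value into digit
  and tail is ambiguous just at integers; a remainder strictly between 0 and 1 excludes
  this.\<close>

lemma digit_eqI:
  assumes "\<theta> * Y j = of_int d + r" "0 < r" "r < 1"
  shows "int (b (j - 1)) = d" "Y (j - 1) = r"
proof -
  have "real (b (j - 1)) + Y (j - 1) = of_int d + r"
    using assms tail_step by simp
  then have "real_of_int (int (b (j - 1))) < of_int (d + 1)" "real_of_int d < of_int (int (b (j - 1)) + 1)"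
    using tail_nonneg[of "j - 1"] tail_le_1[of "j - 1"] assms by auto
  then show "int (b (j - 1)) = d"
    by linarith
  then have "real (b (j - 1)) = of_int d"
    by (metis of_int_of_nat_eq)
  with tail_step[of j] assms show "Y (j - 1) = r"
    by simp
qed

lemma infinite_fibonacci_relation_if_tail_1:
  assumes a: "\<theta> ^ 2 = of_int a * \<theta> + 1" and "Y j = 1"
  shows "has_infinite_fibonacci_relation \<theta> b"
proof -
  have inv: "0 < 1 / \<theta>" "1 / \<theta> < 1" "\<theta> = of_int a + 1 / \<theta>"
    using theta_gt_1 a by (auto simp: field_simps power2_eq_square)
  have step: "int (b (i - 1)) = a \<and> Y (i - 2) = 1" if "Y i = 1" for i
  proof
    have d: "\<theta> * Y i = of_int a + 1 / \<theta>"
      using that inv by simp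
    show "int (b (i - 1)) = a"
      using digit_eqI[OF d] inv by simp
    \<comment> \<open>The ambiguous integer case: digit 0 with tail 1, or digit 1 with tail 0. The
      latter would end the expansion.\<close>
    have "real (b (i - 2)) + Y (i - 2) = 1"
      using tail_step[of "i - 1"] digit_eqI[OF d] inv theta_gt_1 by simp
    moreover have "Y (i - 2) > 0"
      using nonzero_tail_below_tail_1[OF that, of 2] tail_nonneg[of "i - 2"] by simp
    ultimately show "Y (i - 2) = 1"
      by (cases "b (i - 2)") auto
  qed
  have "Y (j - 2 * int t) = 1" for t
  proof (induction t)
    case (Suc t)
    then show ?case
      using step[of "j - 2 * int t"] by (simp add: algebra_simps)
  qed (simp add: assms)
  \<comment> \<open>The relation starts at \<open>j - 1\<close>, the highest position covered by
    \<open>Y j\<close>.\<close>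
  then have "int (b (j - 1 - 2 * int t)) = a" for t
    using step[of "j - 2 * int t"] by (simp add: algebra_simps)
  with a show ?thesis
    unfolding has_infinite_fibonacci_relation_def by blast
qed

text \<open>Every remainder here is \<open>r\<close>, strictly between 0 and 1, so
  \<open>digit_eqI\<close> settles all digits without any case of a terminating expansion.\<close>

lemma infinite_forbidden_block_if_tail_1:
  assumes a: "\<theta> ^ 2 = of_int a * \<theta> - 1" and "Y j = 1"
  shows "has_infinite_forbidden_block \<theta> b"
proof -
  define r where "r = 1 - 1 / \<theta>"
  have inv: "0 < r" "r < 1" "\<theta> = of_int (a - 1) + r" "\<theta> * r = of_int (a - 2) + r"
    using theta_gt_1 a by (auto simp: r_def field_simps power2_eq_square)
  have d: "\<theta> * Y j = of_int (a - 1) + r"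
    using assms inv by simp
  have step: "int (b (i - 1)) = a - 2" "Y (i - 1) = r" if "Y i = r" for i
    using digit_eqI[of i "a - 2" r] inv that by simp_all
  have tail: "Y (j - 1 - int t) = r" for t
  proof (induction t)
    case 0
    show ?case
      using digit_eqI[OF d] inv by simp
  next
    case (Suc t)
    then show ?case
      using step(2)[of "j - 1 - int t"] by (simp add: algebra_simps)
  qed
  have "int (b (j - 1 - int t)) = a - 2" if "t \<ge> 1" for t
    using step(1)[OF tail[of "t - 1"]] that by (simp add: of_nat_diff algebra_simps)
  moreover have "int (b (j - 1)) = a - 1"
    using digit_eqI[OF d] inv by simp
  ultimately show ?thesis
    using a unfolding has_infinite_forbidden_block_def by blast
qed

end

section \<open>Minimal equation and norm of a quadratic unit\<close>

lemma irrational_linear_eq_zero: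
  fixes p q :: rat and x :: real
  assumes "x \<notin> \<rat>" "of_rat p * x + of_rat q = 0"
  shows "p = 0" "q = 0"
proof -
  show "p = 0"
  proof (rule ccontr)
    assume "p \<noteq> 0"
    then have "x = of_rat (- q / p)"
      using assms(2) by (simp add: of_rat_divide of_rat_minus field_simps add_eq_0_iff2)
    with assms(1) show False
      by (metis Rats_of_rat)
  qed
  with assms(2) show "q = 0"
    by simp
qed

text \<open>By Vieta the other root is -p - x and the product of the roots is q. Linear independence
  of 1 and x over the rationals makes p, and hence the conjugate, unique.\<close>

lemma quad_norm_eq:
  fixes p q :: rat
  assumes "x \<notin> \<rat>" "x ^ 2 + of_rat p * x + of_rat q = 0"
  shows "quad_norm x = of_rat q"
proof -
  have q: "of_rat q = x * (- of_rat p - x)"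
    using assms(2) by (simp add: algebra_simps power2_eq_square add_eq_0_iff)
  have "quad_conj x = - of_rat p - x"
    unfolding quad_conj_def
  proof (rule the_equality)
    show "\<exists>p' q' :: rat. \<forall>t. t ^ 2 + of_rat p' * t + of_rat q' = (t - x) * (t - (- of_rat p - x))"
      using q by (intro exI[of _ p] exI[of _ q]) (simp add: algebra_simps power2_eq_square)
  next
    fix y assume "\<exists>p' q' :: rat. \<forall>t. t ^ 2 + of_rat p' * t + of_rat q' = (t - x) * (t - y)"
    then obtain p' q' :: rat
      where *: "\<And>t. t ^ 2 + of_rat p' * t + of_rat q' = (t - x) * (t - y)"
      by blast
    have "of_rat (p' - p) * x + of_rat (q' - q) = 0"
      using *[of x] assms(2) by (simp add: of_rat_diff algebra_simps)
    with assms(1) have "p' - p = 0"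
      by (rule irrational_linear_eq_zero)
    moreover have "of_rat p' = - x - y"
      using *[of 0] *[of 1] by (simp add: algebra_simps)
    ultimately show "y = - of_rat p - x"
      by simp
  qed
  with q show ?thesis
    by (simp add: quad_norm_def)
qed

text \<open>Clearing denominators in the equation of the inverse and reducing by that of \<theta>
  leaves a rational linear relation between 1 and \<theta>. Its constant term must vanish, so q' q =
  1, and the norm q is 1 or -1.\<close>

lemma real_quadratic_unit_equation:
  assumes "real_quadratic_unit \<theta>"
  obtains a :: int where "\<theta> ^ 2 = of_int a * \<theta> + 1" "quad_norm \<theta> = -1"
    | a :: int where "\<theta> ^ 2 = of_int a * \<theta> - 1" "quad_norm \<theta> = 1"
proof -
  obtain p q p' q' :: int where irr: "\<theta> \<notin> \<rat>"
    and eq: "\<theta> ^ 2 + of_int p * \<theta> + of_int q = 0"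
    and eq': "inverse \<theta> ^ 2 + of_int p' * inverse \<theta> + of_int q' = 0"
    using assms unfolding real_quadratic_unit_def quadratic_integer_def by blast
  have "\<theta> \<noteq> 0"
    using irr by auto
  have "1 + of_int p' * \<theta> + of_int q' * \<theta> ^ 2 = \<theta> ^ 2 * (inverse \<theta> ^ 2 + of_int p' * inverse \<theta> + of_int q')"
    using \<open>\<theta> \<noteq> 0\<close> by (simp add: field_simps power2_eq_square)
  with eq' have "1 + of_int p' * \<theta> + of_int q' * \<theta> ^ 2 = 0"
    by simp
  moreover have "\<theta> ^ 2 = - of_int p * \<theta> - of_int q"
    using eq by simp
  ultimately have "of_int (p' - q' * p) * \<theta> + of_int (1 - q' * q) = 0"
    by (simp add: algebra_simps)
  then have "of_rat (of_int (p' - q' * p)) * \<theta> + of_rat (of_int (1 - q' * q)) = 0"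
    by (simp only: of_rat_of_int_eq)
  with irr have "of_int (1 - q' * q) = (0 :: rat)"
    by (rule irrational_linear_eq_zero)
  then have "q' * q = 1"
    by (simp only: of_int_eq_0_iff)
  then have "q = 1 \<or> q = -1"
    by (metis zmult_eq_1_iff)
  moreover have "quad_norm \<theta> = of_int q"
    using quad_norm_eq[OF irr, of "of_int p" "of_int q"] eq by simp
  ultimately show thesis
    using that[of "- p"] eq by (auto simp: algebra_simps)
qed

theorem theorem2:
  fixes \<theta> x :: real and m :: int and b :: "int \<Rightarrow> nat"
  assumes "\<theta> > 1"
    and "real_quadratic_unit \<theta>"
    and "theta_expansion \<theta> x m b"
    and "\<And>n. n \<ge> - m \<Longrightarrow> greedy_polynomial \<theta> (partial_digits b m n)"
  shows "is_greedy_expansion \<theta> x b \<longleftrightarrow>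
           (quad_norm \<theta> = -1 \<longrightarrow> \<not> has_infinite_fibonacci_relation \<theta> b) \<and>
           (quad_norm \<theta> = 1 \<longrightarrow> \<not> has_infinite_forbidden_block \<theta> b)"
proof -
  interpret greedy_partial_sums \<theta> x m b
    by unfold_locales (use assms in auto)
  show ?thesis
  proof
    assume "is_greedy_expansion \<theta> x b"
    then show "(quad_norm \<theta> = -1 \<longrightarrow> \<not> has_infinite_fibonacci_relation \<theta> b) \<and>
        (quad_norm \<theta> = 1 \<longrightarrow> \<not> has_infinite_forbidden_block \<theta> b)"
      using no_infinite_fibonacci_relation_if_greedy no_infinite_forbidden_block_if_greedy by blast
  next
    assume *: "(quad_norm \<theta> = -1 \<longrightarrow> \<not> has_infinite_fibonacci_relation \<theta> b) \<and>
        (quad_norm \<theta> = 1 \<longrightarrow> \<not> has_infinite_forbidden_block \<theta> b)"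
    \<comment> \<open>In either norm case, a tail equal to 1 would produce the very pattern excluded
      for that norm.\<close>
    have "Y j \<noteq> 1" for j
      using real_quadratic_unit_equation[OF assms(2)] *
        infinite_fibonacci_relation_if_tail_1 infinite_forbidden_block_if_tail_1 by metis
    with tail_le_1 show "is_greedy_expansion \<theta> x b"
      unfolding greedy_iff_tails_less_1 by (metis order_le_less)
  qed
qed

end
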